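(* Let $\mu$ be a positive finite Borel measure on $[0,1)$ and let $\mathcal{H}_\mu$ be the associated Hankel operator, with matrix $(\mu_{i+j})_{i,j\ge 0}$, where $\mu_n=\int_0^1t^n\,d\mu(t)$. Assume that $\mathcal{H}_\mu$ is a bounded operator on $\ell^2$. For $0\le t<1$ let $V_t$ be the operator on the Hardy space $H^2$ given by $$V_tf(z)=\frac{f(t)}{1-tz}\qquad(f\in H^2,\ z\in\mathbb{D}).$$ Then the only closed subspaces of $H^2$ invariant under every $V_t$, $0\le t<1$, are the trivial ones, $\{0\}$ and $H^2$.
   Context: $\mathbb{D}$ is the open unit disc and $H^2$ is the Hardy space of holomorphic functions $f(z)=\sum_{k\ge 0}x_kz^k$ on $\mathbb{D}$ with $(x_k)_{k\ge 0}\in\ell^2$, identified isometrically with $\ell^2$ via Taylor coefficients. A subspace $M$ is invariant under $T$ if $TM\subseteq M$. (The operator $\mathcal{H}_\mu$ acts on $H^2$ as $\mathcal{H}_\mu f(z)=\int_0^1V_tf(z)\,d\mu(t)$.) *)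

theory Defs
  imports "HOL-Complex_Analysis.Complex_Analysis"
begin

section \<open>The sequence space of square-summable complex sequences\<close>

typedef ell2 = "{x :: nat \<Rightarrow> complex. summable (\<lambda>k. (cmod (x k))\<^sup>2)}"
  morphisms ell2_nth Abs_ell2
  by (rule exI[of _ "\<lambda>_. 0"]) simp

setup_lifting type_definition_ell2

lemma summable_ell2: "summable (\<lambda>k. (cmod (ell2_nth x k))\<^sup>2)"
  using ell2_nth by simp

lemma ell2_eqI: "(\<And>k. ell2_nth x k = ell2_nth y k) \<Longrightarrow> x = y"
  by (metis ell2_nth_inject ext)

lemma square_summable_add:
  fixes x y :: "nat \<Rightarrow> complex"
  assumes "summable (\<lambda>k. (cmod (x k))\<^sup>2)" and "summable (\<lambda>k. (cmod (y k))\<^sup>2)"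
  shows "summable (\<lambda>k. (cmod (x k + y k))\<^sup>2)"
proof (rule summable_comparison_test')
  show "summable (\<lambda>k. 2 * (cmod (x k))\<^sup>2 + 2 * (cmod (y k))\<^sup>2)"
    by (intro summable_add summable_mult assms)
  show "norm ((cmod (x k + y k))\<^sup>2) \<le> 2 * (cmod (x k))\<^sup>2 + 2 * (cmod (y k))\<^sup>2" if "k \<ge> 0" for k
  proof -
    have "(cmod (x k + y k))\<^sup>2 \<le> (cmod (x k) + cmod (y k))\<^sup>2"
      by (intro power_mono norm_triangle_ineq) simp
    also have "\<dots> \<le> 2 * (cmod (x k))\<^sup>2 + 2 * (cmod (y k))\<^sup>2"
      using sum_squares_bound[of "cmod (x k)" "cmod (y k)"] by (simp add: power2_sum)
    finally show ?thesis by simp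
  qed
qed

lemma square_summable_mult:
  fixes x :: "nat \<Rightarrow> complex"
  assumes "summable (\<lambda>k. (cmod (x k))\<^sup>2)"
  shows "summable (\<lambda>k. (cmod (c * x k))\<^sup>2)"
  using summable_mult[OF assms, of "(cmod c)\<^sup>2"] by (simp add: norm_mult power_mult_distrib)

instantiation ell2 :: real_vector
begin

lift_definition zero_ell2 :: ell2 is "\<lambda>_. 0" by simp
lift_definition plus_ell2 :: "ell2 \<Rightarrow> ell2 \<Rightarrow> ell2" is "\<lambda>x y k. x k + y k"
  by (rule square_summable_add)
lift_definition uminus_ell2 :: "ell2 \<Rightarrow> ell2" is "\<lambda>x k. - x k" by simp
lift_definition minus_ell2 :: "ell2 \<Rightarrow> ell2 \<Rightarrow> ell2" is "\<lambda>x y k. x k - y k"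
  subgoal for x y using square_summable_add[of x "\<lambda>k. - y k"] by simp
  done
lift_definition scaleR_ell2 :: "real \<Rightarrow> ell2 \<Rightarrow> ell2" is "\<lambda>r x k. complex_of_real r * x k"
  by (rule square_summable_mult)

instance
  by standard (transfer; simp add: fun_eq_iff algebra_simps)+

end

instantiation ell2 :: real_normed_vector
begin

definition norm_ell2 :: "ell2 \<Rightarrow> real" where
  "norm x = sqrt (\<Sum>k. (cmod (ell2_nth x k))\<^sup>2)"
definition dist_ell2 :: "ell2 \<Rightarrow> ell2 \<Rightarrow> real" where
  "dist (x :: ell2) y = norm (x - y)"
definition sgn_ell2 :: "ell2 \<Rightarrow> ell2" where
  "sgn (x :: ell2) = inverse (norm x) *\<^sub>R x"
definition uniformity_ell2 :: "(ell2 \<times> ell2) filter" where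
  "uniformity = (INF e\<in>{0<..}. principal {(x :: ell2, y). dist x y < e})"
definition open_ell2 :: "ell2 set \<Rightarrow> bool" where
  "open (U :: ell2 set) = (\<forall>x\<in>U. eventually (\<lambda>(x', y). x' = x \<longrightarrow> y \<in> U) uniformity)"

instance
proof
  fix x y :: ell2 and r :: real
  show "dist x y = norm (x - y)" by (fact dist_ell2_def)
  show "sgn x = inverse (norm x) *\<^sub>R x" by (fact sgn_ell2_def)
  show "(uniformity :: (ell2 \<times> ell2) filter) = (INF e\<in>{0<..}. principal {(x, y). dist x y < e})"
    by (fact uniformity_ell2_def)
  show "open U = (\<forall>x\<in>U. eventually (\<lambda>(x', y). x' = x \<longrightarrow> y \<in> U) uniformity)" for U :: "ell2 set"
    by (fact open_ell2_def)
  show "(norm x = 0) = (x = 0)"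
  proof -
    have "(norm x = 0) \<longleftrightarrow> (\<forall>k. (cmod (ell2_nth x k))\<^sup>2 = 0)"
      unfolding norm_ell2_def real_sqrt_eq_zero_cancel_iff
      by (rule suminf_eq_zero_iff[OF summable_ell2]) simp
    also have "\<dots> \<longleftrightarrow> x = 0"
      by (auto intro!: ell2_eqI simp: zero_ell2.rep_eq)
    finally show ?thesis .
  qed
  show "norm (r *\<^sub>R x) = \<bar>r\<bar> * norm x"
    by (simp add: norm_ell2_def scaleR_ell2.rep_eq norm_mult power_mult_distrib
        suminf_mult[OF summable_ell2] real_sqrt_mult)
  have part: "L2_set (\<lambda>k. cmod (ell2_nth z k)) {..<n} \<le> norm z" for z :: ell2 and n
    unfolding L2_set_def norm_ell2_def
    by (intro real_sqrt_le_mono sum_le_suminf summable_ell2) auto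
  have nn: "norm z \<ge> 0" for z :: ell2
    unfolding norm_ell2_def by (intro real_sqrt_ge_zero suminf_nonneg summable_ell2) simp
  have "(\<Sum>k<n. (cmod (ell2_nth (x + y) k))\<^sup>2) \<le> (norm x + norm y)\<^sup>2" for n
  proof -
    have "L2_set (\<lambda>k. cmod (ell2_nth (x + y) k)) {..<n}
        \<le> L2_set (\<lambda>k. cmod (ell2_nth x k) + cmod (ell2_nth y k)) {..<n}"
      by (intro L2_set_mono) (auto simp: plus_ell2.rep_eq norm_triangle_ineq)
    also have "\<dots> \<le> norm x + norm y"
      using L2_set_triangle_ineq[of "\<lambda>k. cmod (ell2_nth x k)" "\<lambda>k. cmod (ell2_nth y k)" "{..<n}"]
        part[of x n] part[of y n] by linarith
    finally show ?thesis
      unfolding L2_set_def by (rule sqrt_le_D)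
  qed
  then have "(\<Sum>k. (cmod (ell2_nth (x + y) k))\<^sup>2) \<le> (norm x + norm y)\<^sup>2"
    by (intro suminf_le_const summable_ell2)
  then show "norm (x + y) \<le> norm x + norm y"
    unfolding norm_ell2_def[of "x + y"] using nn[of x] nn[of y]
    by (intro real_le_lsqrt) auto
qed

end

lemma norm_ell2_power2: "(norm (x :: ell2))\<^sup>2 = (\<Sum>k. (cmod (ell2_nth x k))\<^sup>2)"
  unfolding norm_ell2_def by (simp add: suminf_nonneg[OF summable_ell2])


section \<open>Hankel matrices of measures on [0,1)\<close>

definition moment :: "real measure \<Rightarrow> nat \<Rightarrow> real" where
  "moment \<mu> n = (\<integral>t. t ^ n \<partial>\<mu>)"

text \<open>
  The operator \<open>T\<close> is the Hankel operator of \<open>\<mu>\<close> if it is given by the matrix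
  \<open>(\<mu>\<^sub>i\<^sub>+\<^sub>j)\<close>, that is, the \<open>i\<close>-th coordinate of \<open>T x\<close> is the sum of the (convergent) series
  \<open>\<Sum>j. \<mu>\<^sub>i\<^sub>+\<^sub>j * x\<^sub>j\<close>. This determines \<open>T\<close> uniquely and makes it complex-linear.
\<close>
definition is_hankel_operator :: "real measure \<Rightarrow> (ell2 \<Rightarrow> ell2) \<Rightarrow> bool" where
  "is_hankel_operator \<mu> T \<longleftrightarrow>
     (\<forall>x i. (\<lambda>j. complex_of_real (moment \<mu> (i + j)) * ell2_nth x j) sums ell2_nth (T x) i)"


section \<open>The Hardy space of the unit disc\<close>

definition taylor_coeff :: "(complex \<Rightarrow> complex) \<Rightarrow> nat \<Rightarrow> complex" where
  "taylor_coeff f k = fps_nth (fps_expansion f 0) k"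

text \<open>
  Functions on the disc are represented by total functions that vanish outside it, so that
  equality of elements of the type is equality of functions on the disc.
\<close>
typedef hardy = "{f :: complex \<Rightarrow> complex. f holomorphic_on ball 0 1 \<and> (\<forall>z. z \<notin> ball 0 1 \<longrightarrow> f z = 0)
    \<and> summable (\<lambda>k. (cmod (taylor_coeff f k))\<^sup>2)}"
  morphisms hardy_fun Abs_hardy
  by (rule exI[of _ "\<lambda>_. 0"]) (simp add: taylor_coeff_def fps_expansion_def)

setup_lifting type_definition_hardy

lemma hardy_holomorphic: "hardy_fun f holomorphic_on ball 0 1"
  using hardy_fun[of f] by simp

lemma hardy_outside: "z \<notin> ball 0 1 \<Longrightarrow> hardy_fun f z = 0"
  using hardy_fun[of f] by blast

lemma hardy_sums:
  assumes "z \<in> ball 0 1"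
  shows "(\<lambda>k. taylor_coeff (hardy_fun f) k * z ^ k) sums hardy_fun f z"
  using holomorphic_power_series[OF hardy_holomorphic assms]
  by (simp add: taylor_coeff_def fps_expansion_def)

lemma taylor_coeff_add:
  assumes "f holomorphic_on ball 0 1" "g holomorphic_on ball 0 1"
  shows "taylor_coeff (\<lambda>z. f z + g z) k = taylor_coeff f k + taylor_coeff g k"
  by (simp add: taylor_coeff_def fps_expansion_def higher_deriv_add[OF assms open_ball]
      add_divide_distrib)

lemma taylor_coeff_cmult:
  assumes "f holomorphic_on ball 0 1"
  shows "taylor_coeff (\<lambda>z. c * f z) k = c * taylor_coeff f k"
  by (simp add: taylor_coeff_def fps_expansion_def
      higher_deriv_cmult[OF assms _ open_ball])

lemma taylor_coeff_0: "taylor_coeff (\<lambda>_. 0) k = 0"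
  by (simp add: taylor_coeff_def fps_expansion_def)

instantiation hardy :: real_vector
begin

lift_definition zero_hardy :: hardy is "\<lambda>_. 0" by (simp add: taylor_coeff_0)
lift_definition plus_hardy :: "hardy \<Rightarrow> hardy \<Rightarrow> hardy" is "\<lambda>f g z. f z + g z"
  by (auto intro!: holomorphic_intros square_summable_add simp: taylor_coeff_add)
lift_definition uminus_hardy :: "hardy \<Rightarrow> hardy" is "\<lambda>f z. - f z"
  subgoal for f using taylor_coeff_cmult[of f "-1"] by (auto intro!: holomorphic_intros)
  done
lift_definition minus_hardy :: "hardy \<Rightarrow> hardy \<Rightarrow> hardy" is "\<lambda>f g z. f z - g z"
  subgoal for f g
    using taylor_coeff_add[of f "\<lambda>z. - g z"] taylor_coeff_cmult[of g "-1"]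
      square_summable_add[of "taylor_coeff f" "\<lambda>k. - taylor_coeff g k"]
    by (auto intro!: holomorphic_intros simp: holomorphic_on_minus)
  done
lift_definition scaleR_hardy :: "real \<Rightarrow> hardy \<Rightarrow> hardy" is "\<lambda>r f z. complex_of_real r * f z"
  by (auto intro!: holomorphic_intros square_summable_mult simp: taylor_coeff_cmult)

instance
  by standard (transfer; simp add: fun_eq_iff algebra_simps)+

end

lift_definition scaleC_hardy :: "complex \<Rightarrow> hardy \<Rightarrow> hardy" is "\<lambda>c f z. c * f z"
  by (auto intro!: holomorphic_intros square_summable_mult simp: taylor_coeff_cmult)

lemma vector_space_hardy: "vector_space scaleC_hardy"
  by unfold_locales (transfer; simp add: fun_eq_iff algebra_simps)+

lift_definition hardy_coeffs :: "hardy \<Rightarrow> ell2" is "taylor_coeff" by simp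

lemma ell2_nth_hardy_coeffs: "ell2_nth (hardy_coeffs f) k = taylor_coeff (hardy_fun f) k"
  by (simp add: hardy_coeffs.rep_eq)

lemma hardy_coeffs_add: "hardy_coeffs (f + g) = hardy_coeffs f + hardy_coeffs g"
  by (rule ell2_eqI)
    (simp add: ell2_nth_hardy_coeffs plus_ell2.rep_eq plus_hardy.rep_eq taylor_coeff_add
      hardy_holomorphic)

lemma hardy_coeffs_scaleR: "hardy_coeffs (r *\<^sub>R f) = r *\<^sub>R hardy_coeffs f"
  by (rule ell2_eqI)
    (simp add: ell2_nth_hardy_coeffs scaleR_ell2.rep_eq scaleR_hardy.rep_eq taylor_coeff_cmult
      hardy_holomorphic)

lemma hardy_coeffs_eq_0_iff: "hardy_coeffs f = 0 \<longleftrightarrow> f = 0"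
proof
  assume "hardy_coeffs f = 0"
  then have coeff: "taylor_coeff (hardy_fun f) k = 0" for k
    by (metis ell2_nth_hardy_coeffs zero_ell2.rep_eq)
  have "hardy_fun f z = 0" for z
  proof (cases "z \<in> ball 0 1")
    case True
    from hardy_sums[OF this, of f] show ?thesis by (simp add: coeff sums_iff)
  next
    case False
    then show ?thesis by (rule hardy_outside)
  qed
  then have "hardy_fun f = hardy_fun 0" by (simp add: fun_eq_iff zero_hardy.rep_eq)
  then show "f = 0" by (simp add: hardy_fun_inject)
next
  assume "f = 0"
  then show "hardy_coeffs f = 0"
    by (auto intro!: ell2_eqI
        simp: ell2_nth_hardy_coeffs zero_ell2.rep_eq zero_hardy.rep_eq taylor_coeff_0)
qed

instantiation hardy :: real_normed_vector
begin

definition norm_hardy :: "hardy \<Rightarrow> real" where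
  "norm f = norm (hardy_coeffs f)"
definition dist_hardy :: "hardy \<Rightarrow> hardy \<Rightarrow> real" where
  "dist (f :: hardy) g = norm (f - g)"
definition sgn_hardy :: "hardy \<Rightarrow> hardy" where
  "sgn (f :: hardy) = inverse (norm f) *\<^sub>R f"
definition uniformity_hardy :: "(hardy \<times> hardy) filter" where
  "uniformity = (INF e\<in>{0<..}. principal {(f :: hardy, g). dist f g < e})"
definition open_hardy :: "hardy set \<Rightarrow> bool" where
  "open (U :: hardy set) = (\<forall>f\<in>U. eventually (\<lambda>(f', g). f' = f \<longrightarrow> g \<in> U) uniformity)"

instance
proof
  fix f g :: hardy and r :: real
  show "dist f g = norm (f - g)" by (fact dist_hardy_def)
  show "sgn f = inverse (norm f) *\<^sub>R f" by (fact sgn_hardy_def)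
  show "(uniformity :: (hardy \<times> hardy) filter) = (INF e\<in>{0<..}. principal {(f, g). dist f g < e})"
    by (fact uniformity_hardy_def)
  show "open U = (\<forall>f\<in>U. eventually (\<lambda>(f', g). f' = f \<longrightarrow> g \<in> U) uniformity)" for U :: "hardy set"
    by (fact open_hardy_def)
  show "(norm f = 0) = (f = 0)"
    by (simp add: norm_hardy_def hardy_coeffs_eq_0_iff)
  show "norm (r *\<^sub>R f) = \<bar>r\<bar> * norm f"
    by (simp add: norm_hardy_def hardy_coeffs_scaleR)
  show "norm (f + g) \<le> norm f + norm g"
    by (simp add: norm_hardy_def hardy_coeffs_add norm_triangle_ineq)
qed

end

lemma norm_hardy_power2: "(norm (f :: hardy))\<^sup>2 = (\<Sum>k. (cmod (taylor_coeff (hardy_fun f) k))\<^sup>2)"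
  by (simp add: norm_hardy_def norm_ell2_power2 ell2_nth_hardy_coeffs)


section \<open>The operators \<open>V\<^sub>t\<close>\<close>

text \<open>
  For \<open>\<bar>t\<bar> < 1\<close> the function under \<open>Abs_hardy\<close> is in the Hardy space, so that \<open>V t f\<close> has the
  expected values, see \<open>hardy_fun_V\<close> below. For other \<open>t\<close> the value is not specified.
\<close>
definition V :: "real \<Rightarrow> hardy \<Rightarrow> hardy" where
  "V t f = Abs_hardy (\<lambda>z. if z \<in> ball 0 1
     then hardy_fun f (complex_of_real t) / (1 - complex_of_real t * z) else 0)"

lemma hardy_fun_V:
  assumes "\<bar>t\<bar> < 1"
  shows "hardy_fun (V t f) z = (if z \<in> ball 0 1
     then hardy_fun f (complex_of_real t) / (1 - complex_of_real t * z) else 0)"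
proof -
  define c where "c = hardy_fun f (complex_of_real t)"
  define g where "g = (\<lambda>z. if z \<in> ball 0 1 then c / (1 - complex_of_real t * z) else 0)"
  have lt: "cmod (complex_of_real t * z) < 1" if "z \<in> ball 0 1" for z
  proof -
    have "\<bar>t\<bar> * cmod z \<le> 1 * cmod z" using assms by (intro mult_right_mono) auto
    with that show ?thesis by (simp add: norm_mult)
  qed
  then have nz: "1 - complex_of_real t * z \<noteq> 0" if "z \<in> ball 0 1" for z
    using that by fastforce
  have hol: "(\<lambda>z. c / (1 - complex_of_real t * z)) holomorphic_on ball 0 1"
    using nz by (intro holomorphic_intros) auto
  have "g holomorphic_on ball 0 1"
    by (rule holomorphic_transform[OF hol]) (simp add: g_def)
  moreover have "taylor_coeff g k = c * complex_of_real t ^ k" for k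
  proof -
    define F where "F = Abs_fps (\<lambda>k. c * complex_of_real t ^ k)"
    have sums: "(\<lambda>k. fps_nth F k * z ^ k) sums g z" if "z \<in> ball 0 1" for z
      using sums_mult[OF geometric_sums[OF lt[OF that]], of c] that
      by (simp add: F_def g_def power_mult_distrib mult_ac)
    have "fps_conv_radius F \<ge> 1"
      unfolding fps_conv_radius_def
      by (rule conv_radius_geI_ex') (use sums sums_summable in \<open>force simp: one_ereal_def\<close>)
    then have "fps_conv_radius F > 0"
      using less_le_trans[of 0 "1 :: ereal"] by simp
    moreover have "eventually (\<lambda>z. eval_fps F z = g z) (nhds 0)"
    proof (rule eventually_mono)
      show "eventually (\<lambda>z. z \<in> ball 0 1) (nhds (0 :: complex))"
        by (rule eventually_nhds_in_open) auto
      show "eval_fps F z = g z" if "z \<in> ball 0 1" for z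
        unfolding eval_fps_def using sums[OF that] by (rule sums_unique[symmetric])
    qed
    ultimately have "g has_fps_expansion F"
      by (simp add: has_fps_expansion_def)
    then have "fps_expansion g 0 = F" by (rule fps_expansion_eqI)
    then show ?thesis by (simp add: taylor_coeff_def F_def)
  qed
  moreover have "summable (\<lambda>k. (cmod (c * complex_of_real t ^ k))\<^sup>2)"
  proof (rule square_summable_mult)
    have "summable (\<lambda>k. (t\<^sup>2) ^ k)"
      using assms by (intro summable_geometric) (simp add: abs_square_less_1)
    moreover have "(cmod (complex_of_real t ^ k))\<^sup>2 = (t\<^sup>2) ^ k" for k
    proof -
      have "(cmod (complex_of_real t ^ k))\<^sup>2 = (\<bar>t\<bar>\<^sup>2) ^ k"
        unfolding norm_power norm_of_real by (metis power_mult mult.commute)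
      then show ?thesis by simp
    qed
    ultimately show "summable (\<lambda>k. (cmod (complex_of_real t ^ k))\<^sup>2)" by simp
  qed
  ultimately have "g \<in> {f. f holomorphic_on ball 0 1 \<and> (\<forall>z. z \<notin> ball 0 1 \<longrightarrow> f z = 0)
    \<and> summable (\<lambda>k. (cmod (taylor_coeff f k))\<^sup>2)}"
    by (simp add: g_def)
  then have "hardy_fun (Abs_hardy g) = g" by (rule Abs_hardy_inverse)
  moreover have "V t f = Abs_hardy g" unfolding V_def g_def c_def ..
  ultimately have "hardy_fun (V t f) z = g z" by simp
  then show ?thesis unfolding g_def c_def .
qed

end

theory Submission
  imports Defs
begin

text \<open>
  A nonzero \<open>f \<in> M\<close> does not vanish at some \<open>t \<in> [0,1)\<close>, so \<open>M\<close> contains the kernel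
  \<open>k\<^sub>t(z) = 1/(1 - tz)\<close>; as \<open>k\<^sub>t\<close> has no zeros, applying \<open>V\<^sub>s\<close> to it shows that \<open>M\<close> contains every
  \<open>k\<^sub>s\<close>. Since \<open>k\<^sub>s = \<Sum>\<^sub>n s\<^sup>n z\<^sup>n\<close>, the monomial \<open>z\<^sup>n\<close> is the limit of
  \<open>s\<^sup>-\<^sup>n (k\<^sub>s - \<Sum>\<^sub>j\<^sub><\<^sub>n s\<^sup>j z\<^sup>j)\<close> as \<open>s \<rightarrow> 0\<close>, so by induction \<open>M\<close> contains all monomials, hence \<open>H\<^sup>2\<close>.
\<close>

text \<open>Convergence on the whole disc forces the radius of convergence to be at least 1, hence
  positive, and a formal power series that represents \<open>g\<close> near 0 is unique.\<close>

lemma taylor_coeff_eqI: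
  assumes "\<And>z. z \<in> ball 0 1 \<Longrightarrow> (\<lambda>k. a k * z ^ k) sums g z"
  shows "taylor_coeff g k = a k"
proof -
  have "fps_conv_radius (Abs_fps a) \<ge> 1"
    unfolding fps_conv_radius_def
    by (rule conv_radius_geI_ex') (use assms sums_summable in \<open>force simp: one_ereal_def\<close>)
  then have "fps_conv_radius (Abs_fps a) > 0"
    using less_le_trans[of 0 "1 :: ereal"] by simp
  moreover have "eventually (\<lambda>z. eval_fps (Abs_fps a) z = g z) (nhds 0)"
  proof (rule eventually_mono)
    show "eventually (\<lambda>z. z \<in> ball 0 1) (nhds (0 :: complex))"
      by (rule eventually_nhds_in_open) auto
    show "eval_fps (Abs_fps a) z = g z" if "z \<in> ball 0 1" for z
      unfolding eval_fps_def using assms[OF that] by (simp add: sums_iff)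
  qed
  ultimately have "fps_expansion g 0 = Abs_fps a"
    by (intro fps_expansion_eqI) (simp add: has_fps_expansion_def)
  then show ?thesis by (simp add: taylor_coeff_def)
qed

abbreviation hcoeff :: "hardy \<Rightarrow> nat \<Rightarrow> complex" where
  "hcoeff f \<equiv> taylor_coeff (hardy_fun f)"

lemma hcoeff_scaleC: "hcoeff (scaleC_hardy c f) k = c * hcoeff f k"
  by (simp add: scaleC_hardy.rep_eq taylor_coeff_cmult hardy_holomorphic)

lemma hcoeff_add: "hcoeff (f + g) k = hcoeff f k + hcoeff g k"
  by (simp add: plus_hardy.rep_eq taylor_coeff_add hardy_holomorphic)

lemma hcoeff_diff: "hcoeff (f - g) k = hcoeff f k - hcoeff g k"
  using hcoeff_add[of "f - g" g k] by simp

lemma hcoeff_sum: "hcoeff (sum F A) k = (\<Sum>i\<in>A. hcoeff (F i) k)"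
  by (induction A rule: infinite_finite_induct)
    (simp_all add: hcoeff_add zero_hardy.rep_eq taylor_coeff_0)

lemma hcoeff_V:
  assumes "\<bar>t\<bar> < 1"
  shows "hcoeff (V t f) k = hardy_fun f (complex_of_real t) * complex_of_real t ^ k"
proof (rule taylor_coeff_eqI)
  fix z :: complex assume z: "z \<in> ball 0 1"
  have "\<bar>t\<bar> * cmod z \<le> 1 * cmod z" using assms by (intro mult_right_mono) auto
  with z have "cmod (complex_of_real t * z) < 1" by (simp add: norm_mult)
  from sums_mult[OF geometric_sums[OF this], of "hardy_fun f (complex_of_real t)"] z
  show "(\<lambda>k. hardy_fun f (complex_of_real t) * complex_of_real t ^ k * z ^ k) sums hardy_fun (V t f) z"
    by (simp add: hardy_fun_V[OF assms] power_mult_distrib mult_ac)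
qed

text \<open>The conditional on the right has the shape of the representing function of
  \<open>hardy_monomial\<close>, which is cut off to 0 outside the disc, so
  \<open>taylor_coeff_eqI\<close> applies to it directly.\<close>

lemma monomial_sums:
  fixes z :: complex
  assumes "z \<in> ball 0 1"
  shows "(\<lambda>k. (if k = n then 1 else 0) * z ^ k) sums (if z \<in> ball 0 1 then z ^ n else 0)"
  using sums_single[of n "\<lambda>k. z ^ k"] assms by (simp add: if_distrib[of "\<lambda>c. c * _"] cong: if_cong)

lift_definition hardy_monomial :: "nat \<Rightarrow> hardy" is "\<lambda>n z. if z \<in> ball 0 1 then z ^ n else 0"
proof (intro conjI allI impI)
  fix n
  let ?g = "\<lambda>z :: complex. if z \<in> ball 0 1 then z ^ n else 0"
  show "?g holomorphic_on ball 0 1"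
    by (rule holomorphic_transform[of "\<lambda>z. z ^ n"]) (auto intro!: holomorphic_intros)
  have "taylor_coeff ?g k = (if k = n then 1 else 0)" for k
    by (rule taylor_coeff_eqI) (rule monomial_sums)
  then show "summable (\<lambda>k. (cmod (taylor_coeff ?g k))\<^sup>2)"
    by (intro summable_finite[of "{n}"]) auto
qed auto

lemma hcoeff_monomial: "hcoeff (hardy_monomial n) k = (if k = n then 1 else 0)"
  unfolding hardy_monomial.rep_eq by (rule taylor_coeff_eqI) (rule monomial_sums)

text \<open>The squared norm of the error is a tail of the convergent series of squared
  coefficients. This gives the density of the polynomials in the Hardy space.\<close>

lemma hardy_partial_sums_tendsto:
  "(\<lambda>n. \<Sum>j<n. scaleC_hardy (hcoeff f j) (hardy_monomial j)) \<longlonglongrightarrow> f"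
proof -
  define S where "S n = (\<Sum>j<n. scaleC_hardy (hcoeff f j) (hardy_monomial j))" for n
  define a where "a k = (cmod (hcoeff f k))\<^sup>2" for k
  have a: "summable a" using hardy_fun[of f] by (simp add: a_def[abs_def])
  have coeff: "hcoeff (S n - f) k = (if k < n then 0 else - hcoeff f k)" for n k
    by (simp add: S_def hcoeff_diff hcoeff_sum hcoeff_scaleC hcoeff_monomial
        if_distrib[of "\<lambda>x. _ * x"] sum.delta cong: if_cong)
  have "(norm (S n - f))\<^sup>2 = (\<Sum>k. a (k + n))" for n
  proof -
    have "(\<lambda>k. a (k + n)) sums (\<Sum>k. a (k + n))"
      using a by (simp add: summable_sums summable_iff_shift)
    then have "(\<lambda>k. (cmod (hcoeff (S n - f) (k + n)))\<^sup>2) sums (\<Sum>k. a (k + n))"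
      by (simp add: coeff a_def)
    \<comment> \<open>The first \<open>n\<close> coefficients of the error vanish, so undoing the
      shift leaves the sum unchanged.\<close>
    then have "(\<lambda>k. (cmod (hcoeff (S n - f) k))\<^sup>2) sums (\<Sum>k. a (k + n))"
      by (subst (asm) sums_zero_iff_shift) (simp_all add: coeff)
    then show ?thesis by (simp add: norm_hardy_power2 sums_iff)
  qed
  then have "(\<lambda>n. (norm (S n - f))\<^sup>2) \<longlonglongrightarrow> 0"
    using suminf_exist_split2[OF a] by simp
  then have "(\<lambda>n. sqrt ((norm (S n - f))\<^sup>2)) \<longlonglongrightarrow> sqrt 0"
    by (rule tendsto_real_sqrt)
  then have "(\<lambda>n. norm (S n - f)) \<longlonglongrightarrow> 0" by simp
  then have "S \<longlonglongrightarrow> f" by (simp add: tendsto_norm_zero_iff LIM_zero_iff)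
  then show ?thesis by (simp add: S_def[abs_def])
qed

lemma subspace_hardyD:
  assumes "module.subspace scaleC_hardy M"
  shows "f \<in> M \<Longrightarrow> scaleC_hardy c f \<in> M"
    "f \<in> M \<Longrightarrow> g \<in> M \<Longrightarrow> f - g \<in> M" "(\<And>i. i \<in> A \<Longrightarrow> F i \<in> M) \<Longrightarrow> sum F A \<in> M"
proof -
  interpret vector_space scaleC_hardy by (rule vector_space_hardy)
  show "f \<in> M \<Longrightarrow> scaleC_hardy c f \<in> M"
    "f \<in> M \<Longrightarrow> g \<in> M \<Longrightarrow> f - g \<in> M" "(\<And>i. i \<in> A \<Longrightarrow> F i \<in> M) \<Longrightarrow> sum F A \<in> M"
    using subspace_scale[OF assms] subspace_diff[OF assms] subspace_sum[OF assms]
    by blast+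
qed

text \<open>Otherwise the zeros would accumulate at 0, an interior point of the disc, and the
  identity theorem would give \<open>f = 0\<close>.\<close>

lemma hardy_fun_nonzero_point:
  assumes "f \<noteq> 0"
  obtains t :: real where "t \<in> {0..<1}" "hardy_fun f (complex_of_real t) \<noteq> 0"
proof (rule ccontr)
  assume "\<not> thesis"
  with that have zero: "hardy_fun f (complex_of_real t) = 0" if "t \<in> {0..<1}" for t
    using that by blast
  define U where "U = complex_of_real ` {0..<1}"
  have "(0 :: complex) islimpt U"
    unfolding islimpt_approachable
  proof (intro allI impI)
    fix e :: real assume "e > 0"
    then show "\<exists>x'\<in>U. x' \<noteq> 0 \<and> dist x' 0 < e"
      by (intro bexI[of _ "complex_of_real (min (e / 2) (1 / 2))"]) (auto simp: U_def min_def)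
  qed
  then have "hardy_fun f z = 0" if "z \<in> ball 0 1" for z
    by (rule analytic_continuation[OF hardy_holomorphic[of f], rotated 4])
      (use that zero in \<open>auto simp: U_def\<close>)
  then have "hardy_fun f = hardy_fun 0"
    using hardy_outside[of _ f] by (fastforce simp: zero_hardy.rep_eq fun_eq_iff)
  with assms show False by (simp add: hardy_fun_inject)
qed

text \<open>The coefficients \<open>s\<^sup>k\<close> characterise the kernel \<open>k\<^sub>s(z) = 1/(1 - sz)\<close>.\<close>
lemma monomials_in_closed_subspace:
  assumes M: "module.subspace scaleC_hardy M" "closed M"
    and kernels: "\<And>s. 0 \<le> s \<Longrightarrow> s < 1 \<Longrightarrow> \<exists>g\<in>M. \<forall>k. hcoeff g k = complex_of_real s ^ k"
  shows "hardy_monomial n \<in> M"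
proof (induction n rule: less_induct)
  case (less n)
  have "\<exists>y\<in>M. dist y (hardy_monomial n) < e" if "e > 0" for e
  proof -
    \<comment> \<open>The distance will be at most \<open>2 * s\<close>, and \<open>e / 4\<close>
      makes this less than \<open>e\<close>. The cap \<open>1 / 2\<close> keeps \<open>s\<close>
      below 1 and bounds \<open>1 / (1 - s\<^sup>2)\<close>.\<close>
    define s where "s = min (e / 4) (1 / 2)"
    have s: "0 < s" "s \<le> 1 / 2" "2 * s < e" using that by (auto simp: s_def)
    obtain g where g: "g \<in> M" "\<And>k. hcoeff g k = complex_of_real s ^ k"
      using kernels[of s] s by auto
    \<comment> \<open>The subtracted terms lie in \<open>M\<close> by the induction hypothesis.
      Dividing by \<open>s ^ n\<close> turns the coefficient at \<open>n\<close> into 1.\<close>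
    define y where "y = scaleC_hardy (inverse (complex_of_real s ^ n))
      (g - (\<Sum>j<n. scaleC_hardy (complex_of_real s ^ j) (hardy_monomial j)))"
    have "y \<in> M"
      unfolding y_def using g less by (intro subspace_hardyD[OF M(1)]) auto
    \<comment> \<open>At \<open>k = n\<close> the two coefficients 1 cancel, hence the bound
      \<open>Suc n\<close>; what remains starts with \<open>s\<close>.\<close>
    have coeff: "hcoeff (y - hardy_monomial n) k
      = (if k < Suc n then 0 else complex_of_real s ^ (k - n))" for k
    proof -
      have "hcoeff y k = (if k < n then 0 else complex_of_real s ^ k / complex_of_real s ^ n)"
        by (simp add: y_def hcoeff_diff hcoeff_sum hcoeff_scaleC hcoeff_monomial g field_simps
            if_distrib[of "\<lambda>x. _ * x"] sum.delta cong: if_cong)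
      then show ?thesis
        using s by (auto simp: hcoeff_diff hcoeff_monomial power_diff)
    qed
    have s2: "s\<^sup>2 \<le> 1 / 4" using power_mono[OF s(2), of 2] s(1) by (simp add: power_divide)
    have "(\<lambda>k. s\<^sup>2 * (s\<^sup>2) ^ k) sums (s\<^sup>2 * (1 / (1 - s\<^sup>2)))"
      using s2 by (intro sums_mult geometric_sums) simp
    moreover have "(cmod (hcoeff (y - hardy_monomial n) (k + Suc n)))\<^sup>2 = s\<^sup>2 * (s\<^sup>2) ^ k" for k
      using s(1) by (simp add: coeff norm_power norm_mult power_mult_distrib
          flip: power_mult) (simp add: mult.commute)
    ultimately have "(\<lambda>k. (cmod (hcoeff (y - hardy_monomial n) (k + Suc n)))\<^sup>2)
        sums (s\<^sup>2 * (1 / (1 - s\<^sup>2)))"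
      by presburger
    then have "(\<lambda>k. (cmod (hcoeff (y - hardy_monomial n) k))\<^sup>2) sums (s\<^sup>2 * (1 / (1 - s\<^sup>2)))"
      by (subst (asm) sums_zero_iff_shift) (simp_all add: coeff)
    then have "(norm (y - hardy_monomial n))\<^sup>2 = s\<^sup>2 * (1 / (1 - s\<^sup>2))"
      by (simp add: norm_hardy_power2 sums_iff)
    \<comment> \<open>The factor is at most 4/3; the cruder bound 4 is a perfect square.\<close>
    also have "\<dots> \<le> s\<^sup>2 * 4"
      using s2 by (intro mult_left_mono) (auto simp: field_simps)
    also have "\<dots> = (2 * s)\<^sup>2" by (simp add: power_mult_distrib)
    finally have "norm (y - hardy_monomial n) \<le> 2 * s"
      using s(1) by (auto intro: power2_le_imp_le)
    with s \<open>y \<in> M\<close> show ?thesis by (auto simp: dist_norm intro!: bexI[of _ y])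
  qed
  then have "hardy_monomial n \<in> closure M" by (simp add: closure_approachable)
  with M(2) show ?case by simp
qed

lemma invariant_subspace_eq_UNIV:
  assumes M: "module.subspace scaleC_hardy M" "closed M"
    and inv: "\<And>t. t \<in> {0..<1} \<Longrightarrow> V t ` M \<subseteq> M"
    and f: "f \<in> M" "f \<noteq> 0"
  shows "M = UNIV"
proof -
  obtain t where t: "t \<in> {0..<1}" "hardy_fun f (complex_of_real t) \<noteq> 0"
    using hardy_fun_nonzero_point[OF f(2)] by blast
  \<comment> \<open>This is a nonzero multiple of the kernel at \<open>t\<close>, so unlike
    \<open>f\<close> it vanishes nowhere on the disc.\<close>
  define h where "h = V t f"
  have "h \<in> M" using inv[OF t(1)] f(1) by (auto simp: h_def)
  have kernels: "\<exists>g\<in>M. \<forall>k. hcoeff g k = complex_of_real s ^ k" if s: "0 \<le> s" "s < 1" for s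
  proof -
    have "t * s < 1" using t(1) s mult_strict_mono'[of t 1 s 1] by simp
    then have "1 - complex_of_real t * complex_of_real s \<noteq> 0"
      by (metis eq_iff_diff_eq_0 less_irrefl of_real_eq_1_iff of_real_mult)
    then have nz: "hardy_fun h (complex_of_real s) \<noteq> 0"
      using t s by (simp add: h_def hardy_fun_V)
    \<comment> \<open>\<open>V s h\<close> has coefficients \<open>h(s) * s ^ k\<close>; dividing by
      the nonzero value \<open>h(s)\<close> leaves exactly \<open>s ^ k\<close>.\<close>
    have "V s h \<in> M" using inv[of s] s \<open>h \<in> M\<close> by auto
    with nz s show ?thesis
      by (intro bexI[of _ "scaleC_hardy (inverse (hardy_fun h (complex_of_real s))) (V s h)"])
        (auto simp: hcoeff_scaleC hcoeff_V intro!: subspace_hardyD[OF M(1)])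
  qed
  have "g \<in> M" for g
    by (rule closed_sequentially[OF M(2) _ hardy_partial_sums_tendsto[of g]])
      (intro subspace_hardyD[OF M(1)] monomials_in_closed_subspace[OF M kernels])
  then show ?thesis by auto
qed

theorem theorem4p2:
  fixes \<mu> :: "real measure" and H\<^sub>\<mu> :: "ell2 \<Rightarrow> ell2"
  assumes "finite_measure \<mu>"
    and "sets \<mu> = sets (restrict_space borel {0..<1})"
    and "is_hankel_operator \<mu> H\<^sub>\<mu>"
    and "bounded_linear H\<^sub>\<mu>"
  shows "{M :: hardy set. module.subspace scaleC_hardy M \<and> closed M
            \<and> (\<forall>t\<in>{0..<1}. V t ` M \<subseteq> M)} = {{0}, UNIV}"
proof -
  interpret vector_space scaleC_hardy by (rule vector_space_hardy)
  have "V t 0 = 0" if "t \<in> {0..<1}" for t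
  proof -
    have "hardy_fun (V t 0) = hardy_fun 0"
      using that by (simp add: fun_eq_iff hardy_fun_V zero_hardy.rep_eq)
    then show ?thesis by (simp add: hardy_fun_inject)
  qed
  then have "subspace {0} \<and> closed {0 :: hardy} \<and> (\<forall>t\<in>{0..<1}. V t ` {0} \<subseteq> {0})"
    by simp
  moreover have "subspace UNIV" by (rule subspace_UNIV)
  moreover have "M = {0} \<or> M = UNIV"
    if "subspace M" "closed M" "\<forall>t\<in>{0..<1}. V t ` M \<subseteq> M" for M
    using invariant_subspace_eq_UNIV[OF that(1,2)] that(3) subspace_0[OF that(1)] by blast
  ultimately show ?thesis by auto
qed

end
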